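(* Let $D$ be a division ring and let $V$ be a right $D$-vector space with a fixed finite basis $(e_1,\dots,e_n)$, so that every $v\in V$ is written uniquely as $v=\sum_i e_i v^i$ with $v^i\in D$. For $m\in D$ and $v\in V$ put $$m v:=\sum_i e_i\,(m\,v^i),$$ i.e. $mv$ is the image of $v$ under the linear map of the right $D$-vector space $V$ whose matrix in the basis $(e_i)$ is $m\delta$, where $\delta$ is the identity matrix. Then this product makes $V$ a left $D$-vector space.
   Context: Here division rings are associative, with unit, and not necessarily commutative. A linear map of a right $D$-vector space with basis $(e_i)$ and matrix $({}^jA_i)$ sends $\sum_i e_i v^i$ to $\sum_{j,i} e_j\,{}^jA_i\,v^i$. *)

theory Defs
  imports Main
begin

text \<open>
  The library's \<open>module\<close> and \<open>vector_space\<close> require commutative scalars, hence the one-sided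
  versions over a division ring. The additive group is the type class \<open>ab_group_add\<close>,
  so a left and a right structure on the same type share their addition.
\<close>

locale right_vector_space =
  fixes scale :: "'v::ab_group_add \<Rightarrow> 'd::division_ring \<Rightarrow> 'v"
  assumes scale_add_vector: "scale (v + w) a = scale v a + scale w a"
    and scale_add_scalar: "scale v (a + b) = scale v a + scale v b"
    and scale_scale: "scale (scale v a) b = scale v (a * b)"
    and scale_one: "scale v 1 = v"

locale left_vector_space =
  fixes scale :: "'d::division_ring \<Rightarrow> 'v::ab_group_add \<Rightarrow> 'v"
  assumes scale_add_vector: "scale a (v + w) = scale a v + scale a w"
    and scale_add_scalar: "scale (a + b) v = scale a v + scale b v"
    and scale_scale: "scale a (scale b v) = scale (a * b) v"
    and scale_one: "scale 1 v = v"

definition right_lincomb ::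
  "('v::ab_group_add \<Rightarrow> 'd::division_ring \<Rightarrow> 'v) \<Rightarrow> nat \<Rightarrow> (nat \<Rightarrow> 'v) \<Rightarrow> (nat \<Rightarrow> 'd) \<Rightarrow> 'v"
  where "right_lincomb scale n e c = (\<Sum>i=1..n. scale (e i) (c i))"

text \<open>For \<open>n = 0\<close> this is the empty basis of the zero space.\<close>

definition right_basis ::
  "('v::ab_group_add \<Rightarrow> 'd::division_ring \<Rightarrow> 'v) \<Rightarrow> nat \<Rightarrow> (nat \<Rightarrow> 'v) \<Rightarrow> bool"
  where "right_basis scale n e \<longleftrightarrow>
    (\<forall>c. right_lincomb scale n e c = 0 \<longrightarrow> (\<forall>i\<in>{1..n}. c i = 0)) \<and>
    (\<forall>v. \<exists>c. v = right_lincomb scale n e c)"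

text \<open>
  Coordinate families are functions on all of \<open>nat\<close>; requiring the value \<open>0\<close> off \<open>{1..n}\<close>
  makes the description determine the function uniquely when \<open>e\<close> is a basis.
\<close>

definition right_coords ::
  "('v::ab_group_add \<Rightarrow> 'd::division_ring \<Rightarrow> 'v) \<Rightarrow> nat \<Rightarrow> (nat \<Rightarrow> 'v) \<Rightarrow> 'v \<Rightarrow> nat \<Rightarrow> 'd"
  where "right_coords scale n e v =
    (THE c. v = right_lincomb scale n e c \<and> (\<forall>i. i \<notin> {1..n} \<longrightarrow> c i = 0))"

definition right_linear ::
  "('v::ab_group_add \<Rightarrow> 'd::division_ring \<Rightarrow> 'v) \<Rightarrow> ('v \<Rightarrow> 'v) \<Rightarrow> bool"
  where "right_linear scale f \<longleftrightarrow>
    (\<forall>v w. f (v + w) = f v + f w) \<and> (\<forall>v a. f (scale v a) = scale (f v) a)"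

text \<open>The entry \<open>A j i\<close> stands in row \<open>j\<close> and column \<open>i\<close>, and multiplies coordinates from the left.\<close>

definition has_matrix ::
  "('v::ab_group_add \<Rightarrow> 'd::division_ring \<Rightarrow> 'v) \<Rightarrow> nat \<Rightarrow> (nat \<Rightarrow> 'v) \<Rightarrow> ('v \<Rightarrow> 'v)
    \<Rightarrow> (nat \<Rightarrow> nat \<Rightarrow> 'd) \<Rightarrow> bool"
  where "has_matrix scale n e f A \<longleftrightarrow>
    (\<forall>c. f (right_lincomb scale n e c) = (\<Sum>j=1..n. \<Sum>i=1..n. scale (e j) (A j i * c i)))"

definition identity_matrix :: "nat \<Rightarrow> nat \<Rightarrow> 'd::division_ring"
  where "identity_matrix j i = (if j = i then 1 else 0)"

definition left_product ::
  "('v::ab_group_add \<Rightarrow> 'd::division_ring \<Rightarrow> 'v) \<Rightarrow> nat \<Rightarrow> (nat \<Rightarrow> 'v) \<Rightarrow> 'd \<Rightarrow> 'v \<Rightarrow> 'v"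
  where "left_product scale n e m v =
    right_lincomb scale n e (\<lambda>i. m * right_coords scale n e v i)"

end

theory Submission
  imports Defs
begin

text \<open>
  In coordinates the action of \<open>m\<close> multiplies every coordinate by \<open>m\<close> from the left. Hence the
  left vector space laws are, coordinate by coordinate, laws of the ring \<open>D\<close>:
  distributivity in either argument, associativity and the left unit. The right scalars multiply
  coordinates from the right, so associativity \<open>m (v a) = (m v) a\<close> also makes the action
  right-linear, and noncommutativity of \<open>D\<close> causes no conflict between the two sides.

  What needs an argument is that the coordinates of a vector may be read off from \<^emph>\<open>any\<close> of its
  expansions, which is the uniqueness part of the basis property. This gives
  \<open>left_product_lincomb\<close>; since every vector is a linear combination of the basis
  (\<open>right_basis_lincombE\<close>), the theorem then reduces to the linearity of \<open>right_lincomb\<close> in the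
  coordinate family.
\<close>

lemma right_scale_zero_vector:
  assumes "right_vector_space scale"
  shows "scale 0 a = 0"
  using right_vector_space.scale_add_vector[OF assms, of 0 0 a] by simp

lemma right_scale_zero_scalar:
  assumes "right_vector_space scale"
  shows "scale v 0 = 0"
  using right_vector_space.scale_add_scalar[OF assms, of v 0 0] by simp

lemma right_lincomb_cong:
  assumes "\<And>i. i \<in> {1..n} \<Longrightarrow> c i = d i"
  shows "right_lincomb scale n e c = right_lincomb scale n e d"
  unfolding right_lincomb_def using assms by (intro sum.cong) auto

lemma right_lincomb_add:
  assumes "right_vector_space scale"
  shows "right_lincomb scale n e (\<lambda>i. c i + d i)
    = right_lincomb scale n e c + right_lincomb scale n e d"
  unfolding right_lincomb_def
  by (simp add: right_vector_space.scale_add_scalar[OF assms] sum.distrib)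

lemma right_lincomb_diff:
  assumes "right_vector_space scale"
  shows "right_lincomb scale n e (\<lambda>i. c i - d i)
    = right_lincomb scale n e c - right_lincomb scale n e d"
  using right_lincomb_add[OF assms, of n e "\<lambda>i. c i - d i" d] by (simp add: algebra_simps)

lemma scale_right_lincomb:
  assumes "right_vector_space scale"
  shows "scale (right_lincomb scale n e c) a = right_lincomb scale n e (\<lambda>i. c i * a)"
proof -
  interpret right_vector_space scale by (fact assms)
  have "scale (\<Sum>i\<in>S. f i) a = (\<Sum>i\<in>S. scale (f i) a)" for S :: "nat set" and f
    by (induction S rule: infinite_finite_induct)
      (simp_all add: scale_add_vector right_scale_zero_vector[OF assms])
  then show ?thesis
    by (simp add: right_lincomb_def scale_scale)
qed

lemma right_basis_lincombE:
  assumes "right_basis scale n e"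
  obtains c where "v = right_lincomb scale n e c"
  using assms unfolding right_basis_def by blast

lemma right_basis_coeffs_unique:
  assumes "right_vector_space scale" and "right_basis scale n e"
    and "right_lincomb scale n e c = right_lincomb scale n e d" and "i \<in> {1..n}"
  shows "c i = d i"
proof -
  have "right_lincomb scale n e (\<lambda>i. c i - d i) = 0"
    using assms(3) by (simp add: right_lincomb_diff[OF assms(1)])
  then have "c i - d i = 0"
    using assms(2,4) unfolding right_basis_def by blast
  then show ?thesis by simp
qed

text \<open>
  Linear independence determines a coefficient family only on \<open>{1..n}\<close>. The family that
  \<open>right_coords\<close> describes is therefore \<open>c\<close> cut off to \<open>0\<close> outside \<open>{1..n}\<close>.
\<close>

lemma right_coords_lincomb:
  assumes "right_vector_space scale" and "right_basis scale n e"
  shows "right_coords scale n e (right_lincomb scale n e c)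
    = (\<lambda>i. if i \<in> {1..n} then c i else 0)"
  unfolding right_coords_def
proof (rule the_equality)
  show "right_lincomb scale n e c = right_lincomb scale n e (\<lambda>i. if i \<in> {1..n} then c i else 0) \<and>
      (\<forall>i. i \<notin> {1..n} \<longrightarrow> (if i \<in> {1..n} then c i else 0) = 0)"
    by (auto intro: right_lincomb_cong)
next
  fix d
  assume "right_lincomb scale n e c = right_lincomb scale n e d \<and> (\<forall>i. i \<notin> {1..n} \<longrightarrow> d i = 0)"
  then show "d = (\<lambda>i. if i \<in> {1..n} then c i else 0)"
    using right_basis_coeffs_unique[OF assms, of c d] by (intro ext) auto
qed

text \<open>
  This removes the definite description from the product: a vector may be multiplied through an
  arbitrary expansion in the basis, so an identity between products becomes an identity between
  coefficients.
\<close>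

lemma left_product_lincomb:
  assumes "right_vector_space scale" and "right_basis scale n e"
  shows "left_product scale n e m (right_lincomb scale n e c)
    = right_lincomb scale n e (\<lambda>i. m * c i)"
  unfolding left_product_def right_coords_lincomb[OF assms]
  by (rule right_lincomb_cong) simp

lemma left_vector_space_left_product:
  assumes "right_vector_space scale" and "right_basis scale n e"
  shows "left_vector_space (left_product scale n e)"
proof
  fix a b :: 'b and v w :: 'a
  obtain c where v: "v = right_lincomb scale n e c"
    using assms(2) by (rule right_basis_lincombE)
  obtain d where w: "w = right_lincomb scale n e d"
    using assms(2) by (rule right_basis_lincombE)
  note product = left_product_lincomb[OF assms]
  note add = right_lincomb_add[OF assms(1), symmetric]
  show "left_product scale n e a (v + w) = left_product scale n e a v + left_product scale n e a w"
    by (simp add: v w product add distrib_left)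
  show "left_product scale n e (a + b) v = left_product scale n e a v + left_product scale n e b v"
    by (simp add: v product add distrib_right)
  show "left_product scale n e a (left_product scale n e b v) = left_product scale n e (a * b) v"
    by (simp add: v product mult.assoc)
  show "left_product scale n e 1 v = v"
    by (simp add: v product)
qed

lemma right_linear_left_product:
  assumes "right_vector_space scale" and "right_basis scale n e"
  shows "right_linear scale (left_product scale n e m)"
  unfolding right_linear_def
proof (intro conjI allI)
  fix v w
  show "left_product scale n e m (v + w) = left_product scale n e m v + left_product scale n e m w"
    using left_vector_space_left_product[OF assms] by (rule left_vector_space.scale_add_vector)
next
  fix v a
  obtain c where "v = right_lincomb scale n e c"
    using assms(2) by (rule right_basis_lincombE)
  then show "left_product scale n e m (scale v a) = scale (left_product scale n e m v) a"
    by (simp add: scale_right_lincomb[OF assms(1)] left_product_lincomb[OF assms] mult.assoc)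
qed

lemma has_matrix_left_product:
  assumes "right_vector_space scale" and "right_basis scale n e"
  shows "has_matrix scale n e (left_product scale n e m) (\<lambda>j i. m * identity_matrix j i)"
  unfolding has_matrix_def
proof
  fix c
  have "(\<Sum>i=1..n. scale (e j) (m * identity_matrix j i * c i)) = scale (e j) (m * c j)"
    if "j \<in> {1..n}" for j
  proof -
    have "scale (e j) (m * identity_matrix j i * c i) = (if j = i then scale (e j) (m * c j) else 0)"
      for i
      by (simp add: identity_matrix_def right_scale_zero_scalar[OF assms(1)])
    then show ?thesis using that by simp
  qed
  then show "left_product scale n e m (right_lincomb scale n e c)
      = (\<Sum>j=1..n. \<Sum>i=1..n. scale (e j) (m * identity_matrix j i * c i))"
    unfolding left_product_lincomb[OF assms] by (simp add: right_lincomb_def)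
qed

theorem theorem2p3p1:
  fixes scale :: "'v::ab_group_add \<Rightarrow> 'd::division_ring \<Rightarrow> 'v"
    and n :: nat
    and e :: "nat \<Rightarrow> 'v"
  assumes "right_vector_space scale"
    and "right_basis scale n e"
  shows "left_vector_space (left_product scale n e) \<and>
    (\<forall>m. right_linear scale (left_product scale n e m) \<and>
         has_matrix scale n e (left_product scale n e m) (\<lambda>j i. m * identity_matrix j i))"
  using left_vector_space_left_product[OF assms] right_linear_left_product[OF assms]
    has_matrix_left_product[OF assms]
  by blast

end
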